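(* Let $n,k$ be nonnegative integers. Then $\mathsf{des}$ and $\mathsf{exc}$ are equidistributed over $\mathfrak{P}_{n,k}$; that is, for every integer $m\ge0$, $$|\{\pi\in\mathfrak{P}_{n,k}:\mathsf{des}(\pi)=m\}|=|\{\pi\in\mathfrak{P}_{n,k}:\mathsf{exc}(\pi)=m\}|.$$
   Context: A partial permutation of order $n$ is an $n\times n$ $(0,1)$-matrix $\pi=(\pi_{i,j})$ with at most one $1$ in each row and each column; $\mathfrak{P}_{n,k}$ is the set of those with exactly $k$ zero rows. The one-line notation of $\pi$ is the word $\pi_1\pi_2\cdots\pi_n$ with $\pi_i=j$ if $\pi_{i,j}=1$, and $\pi_i=\mathsf{X}$ if the $i$-th row is zero. $\mathsf{exc}(\pi)$ is the number of indices $i$ such that $\pi_{i,j}=1$ for some $j>i$. For a word $\mathsf{c}=c_1\cdots c_m$ of integers, $\mathsf{des}(\mathsf{c})=|\{i:c_i>c_{i+1}\}|$. For $\pi\in\mathfrak{P}_{n,k}$ let $j_1<\cdots<j_k$ be the numbers in $\{1,\ldots,n\}$ not appearing in the one-line notation of $\pi$, and write the one-line notation as $\pi_{(1)}\mathsf{X}\pi_{(2)}\mathsf{X}\cdots\mathsf{X}\pi_{(k+1)}$, where each $\pi_{(i)}$ is a (possibly empty) word of integers. Then $$\mathsf{des}(\pi)=\mathsf{des}(\pi_{(1)}j_1)+\mathsf{des}(\pi_{(2)}j_2)+\cdots+\mathsf{des}(\pi_{(k)}j_k)+\mathsf{des}(\pi_{(k+1)}),$$ where $\pi_{(i)}j_i$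 is the word $\pi_{(i)}$ followed by the letter $j_i$. *)

theory Defs
  imports "Jordan_Normal_Form.Matrix"
begin

text \<open>
  Matrices of the library have rows and columns numbered \<open>0, \<dots>, n - 1\<close>. One-line notation uses the
  letters \<open>1, \<dots>, n\<close>, so row/column \<open>i\<close> of a matrix stands for the index \<open>i + 1\<close>.
\<close>

definition zero_rows :: "nat mat \<Rightarrow> nat set" where
  "zero_rows \<pi> = {i. i < dim_row \<pi> \<and> (\<forall>j < dim_col \<pi>. \<pi> $$ (i, j) = 0)}"

definition partial_permutation :: "nat \<Rightarrow> nat mat \<Rightarrow> bool" where
  "partial_permutation n \<pi> \<longleftrightarrow>
     \<pi> \<in> carrier_mat n n \<and>
     (\<forall>i < n. \<forall>j < n. \<pi> $$ (i, j) \<in> {0, 1}) \<and>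
     (\<forall>i < n. card {j. j < n \<and> \<pi> $$ (i, j) = 1} \<le> 1) \<and>
     (\<forall>j < n. card {i. i < n \<and> \<pi> $$ (i, j) = 1} \<le> 1)"

definition partial_perms :: "nat \<Rightarrow> nat \<Rightarrow> nat mat set" where
  "partial_perms n k = {\<pi>. partial_permutation n \<pi> \<and> card (zero_rows \<pi>) = k}"

lemma finite_partial_perms: "finite (partial_perms n k)"
proof (rule finite_subset)
  let ?F = "PiE ({..<n} \<times> {..<n}) (\<lambda>_. {0, 1 :: nat})"
  show "partial_perms n k \<subseteq> mat n n ` ?F"
  proof
    fix \<pi> assume "\<pi> \<in> partial_perms n k"
    then have *: "\<pi> \<in> carrier_mat n n" "\<forall>i<n. \<forall>j<n. \<pi> $$ (i, j) \<in> {0, 1}"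
      by (auto simp: partial_perms_def partial_permutation_def)
    then have "\<pi> = mat n n (restrict (\<lambda>ij. \<pi> $$ ij) ({..<n} \<times> {..<n}))"
      by (intro eq_matI) auto
    moreover have "restrict (\<lambda>ij. \<pi> $$ ij) ({..<n} \<times> {..<n}) \<in> ?F"
      using *(2) by (intro restrict_PiE_iff[THEN iffD2]) auto
    ultimately show "\<pi> \<in> mat n n ` ?F" by blast
  qed
qed (intro finite_imageI finite_PiE, auto)

definition exc :: "nat mat \<Rightarrow> nat" where
  "exc \<pi> = card {i. i < dim_row \<pi> \<and> (\<exists>j < dim_col \<pi>. j > i \<and> \<pi> $$ (i, j) = 1)}"

text \<open>The letter \<open>X\<close> of a zero row is encoded as \<^term>\<open>None\<close>.\<close>

definition one_line :: "nat mat \<Rightarrow> nat option list" where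
  "one_line \<pi> =
     map (\<lambda>i. if i \<in> zero_rows \<pi> then None
              else Some (Suc (THE j. j < dim_col \<pi> \<and> \<pi> $$ (i, j) = 1)))
         [0..<dim_row \<pi>]"

definition missing :: "nat mat \<Rightarrow> nat list" where
  "missing \<pi> = sorted_list_of_set {j \<in> {1..dim_row \<pi>}. Some j \<notin> set (one_line \<pi>)}"

text \<open>The maximal blocks between the letters \<^term>\<open>None\<close>, empty blocks included.\<close>

fun blocks :: "'a option list \<Rightarrow> 'a list list" where
  "blocks [] = [[]]"
| "blocks (None # w) = [] # blocks w"
| "blocks (Some a # w) = (a # hd (blocks w)) # tl (blocks w)"

lemma length_blocks: "length (blocks w) = Suc (length (filter (\<lambda>x. x = None) w))"
  by (induction w rule: blocks.induct) auto

definition des_word :: "nat list \<Rightarrow> nat" where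
  "des_word c = card {i. i + 1 < length c \<and> c ! i > c ! (i + 1)}"

definition des :: "nat mat \<Rightarrow> nat" where
  "des \<pi> =
     (let k = card (zero_rows \<pi>); b = blocks (one_line \<pi>); j = missing \<pi>
      in (\<Sum>i<k. des_word (b ! i @ [j ! i])) + des_word (b ! k))"

end

theory Submission
  imports Defs
begin

text \<open>
  Fill the blanks of the one-line notation with the missing letters in increasing order. In every
  block but the last, each letter is sent to the next one, a filled-in letter ending a path; the
  last block is turned into cycles by Foata's correspondence, cutting it in front of each
  left-to-right maximum and closing up the pieces. Since closing up never creates or destroys a
  descent, the descents of the word become the edges going down, i.e. the excedances of the inverse.
  The word can be read off from right to left, so this is an injection from a finite set to itself.
\<close>

section \<open>Words with marked positions\<close>

definition final_block :: "nat \<Rightarrow> nat set \<Rightarrow> nat set" where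
  "final_block n X = {i. i < n \<and> (\<forall>x\<in>X. x < i)}"

text \<open>In the final block \<open>M\<close> is the last left-to-right maximum so far, i.e. the
  first letter of the current piece. A next letter above \<open>M\<close>, or the end of the word,
  ends the piece, which becomes a cycle by returning to \<open>M\<close>. The value at a marked
  position is a dummy: \<open>edges\<close> skips it.\<close>

definition successor :: "nat \<Rightarrow> (nat \<Rightarrow> nat) \<Rightarrow> nat set \<Rightarrow> nat \<Rightarrow> nat" where
  "successor n s X i =
     (if i \<in> final_block n X
      then let M = Max (s ` (final_block n X \<inter> {..i}))
           in if Suc i < n \<and> s (Suc i) < M then s (Suc i) else M
      else s (Suc i))"

definition edges :: "nat \<Rightarrow> (nat \<Rightarrow> nat) \<Rightarrow> nat set \<Rightarrow> (nat \<times> nat) set" where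
  "edges n s X = (\<lambda>i. (s i, successor n s X i)) ` ({..<n} - X)"

text \<open>Abstracts a one-line notation with its blanks filled: \<open>X\<close> holds the
  positions of the blanks, and \<open>mono\<close> records that the missing letters enter in
  increasing order.\<close>

locale marked_word =
  fixes n :: nat and s :: "nat \<Rightarrow> nat" and X :: "nat set"
  assumes bij: "bij_betw s {..<n} {1..n}"
    and X_subset: "X \<subseteq> {..<n}"
    and mono: "strict_mono_on X s"
begin

abbreviation "T \<equiv> final_block n X"
abbreviation "sc \<equiv> successor n s X"
abbreviation "E \<equiv> edges n s X"
abbreviation "rec i \<equiv> Max (s ` (T \<inter> {..i}))"

lemma s_eq_iff: "i < n \<Longrightarrow> j < n \<Longrightarrow> s i = s j \<longleftrightarrow> i = j"
  using bij by (auto simp: bij_betw_def inj_on_def)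

lemma s_range: "i < n \<Longrightarrow> s i \<in> {1..n}"
  using bij by (auto simp: bij_betw_def)

lemma T_subset: "T \<subseteq> {..<n} - X"
  by (auto simp: final_block_def)

lemma T_up: "i \<in> T \<Longrightarrow> i \<le> j \<Longrightarrow> j < n \<Longrightarrow> j \<in> T"
  by (auto simp: final_block_def)

lemma rec_mem:
  assumes "i \<in> T"
  obtains l where "l \<in> T" "l \<le> i" "rec i = s l"
proof -
  have "rec i \<in> s ` (T \<inter> {..i})"
    using assms by (intro Max_in) auto
  then show ?thesis using that by blast
qed

lemma s_le_rec: "l \<in> T \<Longrightarrow> l \<le> i \<Longrightarrow> s l \<le> rec i"
  by (intro Max_ge) auto

text \<open>Such a position has a mark strictly to its right, so a single step cannot pass the last
  mark.\<close>

lemma Suc_before_mark: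
  assumes "i < n" "i \<notin> X" "i \<notin> T" shows "Suc i < n \<and> Suc i \<notin> T"
proof -
  obtain x where x: "x \<in> X" "i \<le> x"
    using assms by (auto simp: final_block_def not_less)
  then have "Suc i \<le> x" "x < n"
    using assms X_subset by (auto simp: Suc_le_eq order.order_iff_strict)
  then show ?thesis
    using x by (force simp: final_block_def not_less)
qed

lemma successor_outside: "i \<notin> T \<Longrightarrow> sc i = s (Suc i)"
  by (simp add: successor_def)

lemma successor_inside: "i \<in> T \<Longrightarrow> sc i = (if Suc i < n \<and> s (Suc i) < rec i then s (Suc i) else rec i)"
  by (simp add: successor_def Let_def)

lemma successor_in_T:
  assumes "i \<in> T" shows "sc i \<in> s ` T"
proof -
  obtain l where "l \<in> T" "l \<le> i" "rec i = s l"
    using rec_mem[OF assms] .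
  then show ?thesis
    using T_up[OF assms, of "Suc i"] by (auto simp: successor_inside[OF assms])
qed

lemma successor_notin_T:
  assumes "i < n" "i \<notin> X" "i \<notin> T" shows "sc i \<notin> s ` T"
proof
  assume "sc i \<in> s ` T"
  then obtain l where "l \<in> T" "s (Suc i) = s l"
    using assms by (auto simp: successor_outside)
  then show False
    using Suc_before_mark[OF assms] s_eq_iff[of "Suc i" l] T_subset by auto
qed

lemma successor_range:
  assumes "i < n" "i \<notin> X" shows "sc i \<in> {1..n}"
proof (cases "i \<in> T")
  case True
  then obtain t where "t \<in> T" "sc i = s t"
    using successor_in_T by blast
  then show ?thesis
    using s_range[of t] T_subset by auto
next
  case False
  then show ?thesis
    using Suc_before_mark[OF assms] s_range[of "Suc i"] successor_outside[of i] by simp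
qed

text \<open>The final block keeps its successors to itself, so mixed positions cannot clash. Inside
  it, an ordinary step at \<open>i\<close> yields a letter below every later record; a closing step
  yields the old record, which the next letter exceeds, so all later records are larger too. The
  remaining clashes contradict injectivity of \<open>s\<close>.\<close>

lemma successor_neq:
  assumes "i < j" "j < n" "i \<notin> X" "j \<notin> X"
  shows "sc i \<noteq> sc j"
proof (cases "i \<in> T")
  case False
  show ?thesis
  proof (cases "j \<in> T")
    case True
    then show ?thesis
      using successor_in_T[of j] successor_notin_T[of i] False assms by auto
  next
    case j: False
    then show ?thesis
      using False assms Suc_before_mark[of i] Suc_before_mark[of j] s_eq_iff[of "Suc i" "Suc j"]
      by (auto simp: successor_outside)
  qed
next
  case i: True
  then have j: "j \<in> T" using T_up assms by auto
  have si: "Suc i \<in> T" using T_up[OF i] assms by auto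
  obtain l where l: "l \<in> T" "l \<le> i" "rec i = s l" using rec_mem[OF i] .
  have ln: "l < n" using l(2) assms by simp
  have neq: "s (Suc i) \<noteq> rec i"
    using s_eq_iff[of "Suc i" l] l ln assms by auto
  have mon: "rec i \<le> rec j"
    using s_le_rec[of l j] l assms by simp
  have le: "s (Suc i) \<le> rec j"
    using s_le_rec[OF si] assms by auto
  have 1: "s (Suc i) \<noteq> s (Suc j)" if "Suc j < n"
    using that assms s_eq_iff[of "Suc i" "Suc j"] by auto
  have 2: "rec i \<noteq> s (Suc j)" if "Suc j < n"
    using that assms s_eq_iff[of l "Suc j"] l by auto
  show ?thesis
    using neq mon le 1 2 assms by (auto simp: successor_inside i j)
qed

lemma successor_inj: "inj_on sc ({..<n} - X)"
proof (rule inj_onI)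
  fix i j assume "i \<in> {..<n} - X" "j \<in> {..<n} - X" "sc i = sc j"
  then show "i = j"
    using successor_neq[of i j] successor_neq[of j i] by (cases i j rule: linorder_cases) auto
qed

text \<open>Only a closing step could make a difference. It goes to \<open>rec i\<close>, which is
  at least \<open>s i\<close>, and the letter it replaces, if there is one, is at least
  \<open>rec i\<close>; so neither is a descent.\<close>

lemma descent_successor_iff:
  assumes "i < n" "i \<notin> X"
  shows "sc i < s i \<longleftrightarrow> Suc i < n \<and> s (Suc i) < s i"
proof (cases "i \<in> T")
  case True
  define r where "r = rec i"
  have "s i \<le> r"
    using s_le_rec[of i i] True by (simp only: r_def order_refl)
  then show ?thesis
    using successor_inside[OF True] unfolding r_def[symmetric] by auto
next
  case False
  then show ?thesis
    using Suc_before_mark[OF assms] by (simp add: successor_outside)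
qed

section \<open>The edges as a partial injection on the letters\<close>

lemma edges_iff: "(a, b) \<in> E \<longleftrightarrow> (\<exists>i<n. i \<notin> X \<and> a = s i \<and> b = sc i)"
  by (auto simp: edges_def)

lemma edges_left_unique: "(a, b) \<in> E \<Longrightarrow> (a', b) \<in> E \<Longrightarrow> a = a'"
  using successor_inj by (force simp: edges_iff inj_on_def)

lemma edges_right_unique: "(a, b) \<in> E \<Longrightarrow> (a, b') \<in> E \<Longrightarrow> b = b'"
  by (auto simp: edges_iff s_eq_iff)

lemma edges_subset: "E \<subseteq> {1..n} \<times> {1..n}"
  using s_range successor_range by (fastforce simp: edges_def)

lemma Domain_edges: "Domain E = s ` ({..<n} - X)"
  by (force simp: edges_def)

lemma Range_edges: "Range E = sc ` ({..<n} - X)"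
  by (force simp: edges_def)

lemma marked_values: "s ` X = {1..n} - Domain E"
proof -
  have "s ` ({..<n} - X) = s ` {..<n} - s ` X"
    using bij X_subset by (intro inj_on_image_set_diff[of _ "{..<n}"]) (auto simp: bij_betw_def)
  moreover have "s ` {..<n} = {1..n}"
    using bij by (simp add: bij_betw_def)
  ultimately show ?thesis
    using X_subset s_range unfolding Domain_edges by blast
qed

text \<open>One half of a description of the final letters by edges alone: they form the largest
  subset of \<open>Domain E\<close> closed under \<open>E\<close>.\<close>

lemma closed_final: "s ` T \<subseteq> Domain E" "E `` (s ` T) \<subseteq> s ` T"
proof -
  show "s ` T \<subseteq> Domain E"
    using T_subset by (auto simp: Domain_edges)
  show "E `` (s ` T) \<subseteq> s ` T"
  proof
    fix b assume "b \<in> E `` (s ` T)"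
    then obtain t i where "t \<in> T" "i < n" "s t = s i" "b = sc i"
      by (auto simp: edges_iff)
    then show "b \<in> s ` T"
      using T_subset s_eq_iff[of t i] successor_in_T by auto
  qed
qed

text \<open>Outside the final block, following the edges leads to a marked value, which has no successor.\<close>

lemma closed_subset_final:
  assumes "C \<subseteq> Domain E" "E `` C \<subseteq> C"
  shows "C \<subseteq> s ` T"
proof
  fix c assume c: "c \<in> C"
  then obtain i where i: "i < n" "i \<notin> X" "c = s i"
    using assms by (auto simp: Domain_edges)
  show "c \<in> s ` T"
  proof (rule ccontr)
    assume "c \<notin> s ` T"
    then have "i \<notin> T" using i by auto
    then obtain x where x: "x \<in> X" "i \<le> x"
      using i by (auto simp: final_block_def not_less)
    \<comment> \<open>Walk from \<open>i\<close> to the mark \<open>x\<close>: each letter reached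
      lies in \<open>Domain E\<close>, hence is unmarked, and its edge leads to the next
      letter.\<close>
    have "s l \<in> C" if "i \<le> l" "l \<le> x" for l
      using that
    proof (induction l rule: dec_induct)
      case base
      then show ?case using c i by simp
    next
      case (step l)
      have ln: "l < n" using step x X_subset by auto
      have sl: "s l \<in> C" using step by simp
      then obtain l' where "l' < n" "l' \<notin> X" "s l = s l'"
        using assms by (auto simp: Domain_edges)
      then have "l \<notin> X" using s_eq_iff[of l l'] ln by auto
      moreover have "l \<notin> T" using step x by (force simp: final_block_def not_less)
      ultimately have "(s l, s (Suc l)) \<in> E"
        using ln by (auto simp: edges_iff successor_outside intro!: exI[of _ l])
      then show ?case using sl assms by auto
    qed
    then have "s x \<in> Domain E" using x assms by auto
    then show False
      using marked_values x by auto
  qed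
qed

text \<open>Edges starting in the final block stay there, so only the position directly to the left
  could send an edge to this letter; being marked, it sends none.\<close>

lemma mark_no_predecessor:
  assumes "i \<in> X" "Suc i < n" "Suc i \<notin> T"
  shows "s (Suc i) \<notin> Range E"
proof
  assume "s (Suc i) \<in> Range E"
  then obtain l where l: "l < n" "l \<notin> X" "s (Suc i) = sc l"
    by (auto simp: edges_iff)
  show False
  proof (cases "l \<in> T")
    case True
    then obtain t where "t \<in> T" "s (Suc i) = s t"
      using successor_in_T[of l] l by auto
    then show False
      using s_eq_iff[of "Suc i" t] assms T_subset by auto
  next
    case False
    then show False
      using l assms Suc_before_mark[of l] s_eq_iff[of "Suc i" "Suc l"]
      by (auto simp: successor_outside)
  qed
qed

end

section \<open>Reconstruction of a marked word from its edges\<close>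

locale two_marked_words = a: marked_word n s X + b: marked_word n s' X' for n s X s' X' +
  assumes same_edges: "edges n s X = edges n s' X'"
begin

lemma swapped: "two_marked_words n s' X' s X"
  by unfold_locales (simp add: same_edges)

text \<open>Both sides are the largest closed subset of the domain of the same relation.\<close>

lemma final_values: "s ` a.T = s' ` b.T"
proof
  show "s ` a.T \<subseteq> s' ` b.T"
    using a.closed_final unfolding same_edges by (rule b.closed_subset_final)
  show "s' ` b.T \<subseteq> s ` a.T"
    using b.closed_final unfolding same_edges[symmetric] by (rule a.closed_subset_final)
qed

text \<open>Both blocks are final segments of the positions, hence comparable, and
  \<open>final_values\<close> gives them the same size.\<close>

lemma final_block_subset: "a.T \<subseteq> b.T"
proof (rule ccontr)
  assume "\<not> a.T \<subseteq> b.T"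
  then obtain i where i: "i \<in> a.T" "i \<notin> b.T" by blast
  have "j \<in> a.T" if "j \<in> b.T" for j
    using that i a.T_up[OF i(1), of j] b.T_up[of j i] a.T_subset b.T_subset
    by (cases "i \<le> j") auto
  then have "b.T \<subset> a.T" using i by blast
  then have "card b.T < card a.T"
    using finite_subset[OF a.T_subset] by (intro psubset_card_mono) auto
  moreover have "card (s ` a.T) = card a.T" "card (s' ` b.T) = card b.T"
    using a.T_subset b.T_subset a.bij b.bij
    by (auto intro!: card_image intro: inj_on_subset simp: bij_betw_def)
  ultimately show False using final_values by simp
qed

text \<open>Were \<open>i\<close> unmarked in the second word, its edge would end in the letter at
  \<open>Suc i\<close>, common to both words. In the first word that letter follows a mark and has
  no predecessor.\<close>

lemma mark_step:
  assumes "i < n" "i \<in> X" and eq: "\<And>l. i < l \<Longrightarrow> l < n \<Longrightarrow> s l = s' l"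
    and T: "a.T = b.T"
  shows "i \<in> X'"
proof (rule ccontr)
  assume i: "i \<notin> X'"
  have "i \<notin> b.T" using assms a.T_subset by auto
  then have *: "Suc i < n" "Suc i \<notin> b.T" "b.sc i = s' (Suc i)"
    using b.Suc_before_mark[of i] i assms b.successor_outside by auto
  then have "s' (Suc i) \<in> Range b.E"
    using i assms unfolding b.Range_edges by (metis DiffI image_eqI lessThan_iff)
  then show False
    using a.mark_no_predecessor[of i] assms * same_edges eq[of "Suc i"] by auto
qed

text \<open>The edges determine the set of filled-in letters, so \<open>s i\<close> is also filled
  in somewhere in the second word. This cannot happen to the right of \<open>i\<close>, where the
  words agree; monotonicity on the marks does the rest.\<close>

lemma mark_le:
  assumes "i < n" "i \<in> X" "i \<in> X'" and eq: "\<And>l. i < l \<Longrightarrow> l < n \<Longrightarrow> s l = s' l"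
  shows "s i \<le> s' i"
proof -
  have "s i \<in> s' ` X'"
    using a.marked_values b.marked_values same_edges assms by auto
  then obtain l where l: "l \<in> X'" "s i = s' l" by auto
  have "l < n" using l b.X_subset by auto
  have "\<not> i < l"
    using eq[of l] l \<open>l < n\<close> a.s_eq_iff[of i l] assms by auto
  then show ?thesis
    using l b.mono assms by (cases "l = i") (auto simp: strict_mono_on_def less_imp_le)
qed

end

context two_marked_words
begin

interpretation sw: two_marked_words n s' X' s X by (rule swapped)

lemma final_block_eq: "a.T = b.T"
  using final_block_subset sw.final_block_subset by blast

text \<open>The word is reconstructed from its edges, from right to left.\<close>

lemma same_word: "i \<le> n \<Longrightarrow> \<forall>l. i \<le> l \<longrightarrow> l < n \<longrightarrow> s l = s' l \<and> (l \<in> X \<longleftrightarrow> l \<in> X')"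
proof (induction i rule: inc_induct)
  case base
  then show ?case by simp
next
  case (step i)
  have eq: "\<And>l. i < l \<Longrightarrow> l < n \<Longrightarrow> s l = s' l" using step by auto
  have X: "i \<in> X \<longleftrightarrow> i \<in> X'"
    using mark_step[of i] sw.mark_step[of i] eq final_block_eq step by auto
  have "s i = s' i"
  proof (cases "i \<in> X")
    case True
    then show ?thesis
      \<comment> \<open>The inequality holds with the two words in either role.\<close>
      using X mark_le[of i] sw.mark_le[of i] eq step by (simp add: order_antisym)
  next
    case False
    \<comment> \<open>The end of the edge leaving position \<open>i\<close> is determined before the
      letter at \<open>i\<close> itself is.\<close>
    have "a.sc i = b.sc i"
    proof (cases "i \<in> a.T")
      case True
      \<comment> \<open>The final letters up to \<open>i\<close> are all final letters except those
        already read, so the record at \<open>i\<close> is the same in both words.\<close>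
      have split: "a.T \<inter> {..i} = a.T - {i<..<n}"
        using a.T_subset by auto
      have "s ` (a.T \<inter> {..i}) = s ` a.T - s ` {i<..<n}"
        unfolding split
        by (rule inj_on_image_set_diff[of _ "{..<n}"])
          (use a.T_subset a.bij in \<open>auto simp: bij_betw_def\<close>)
      moreover have "s' ` (a.T \<inter> {..i}) = s' ` a.T - s' ` {i<..<n}"
        unfolding split
        by (rule inj_on_image_set_diff[of _ "{..<n}"])
          (use a.T_subset b.bij in \<open>auto simp: bij_betw_def\<close>)
      moreover have "s ` {i<..<n} = s' ` {i<..<n}"
        using eq by (intro image_cong) auto
      ultimately have "s ` (a.T \<inter> {..i}) = s' ` (b.T \<inter> {..i})"
        using final_values final_block_eq by simp
      then show ?thesis
        using True final_block_eq eq[of "Suc i"]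
        by (auto simp: a.successor_inside b.successor_inside)
    next
      case F: False
      then show ?thesis
        using a.Suc_before_mark[of i] eq[of "Suc i"] False step final_block_eq
        by (auto simp: a.successor_outside b.successor_outside)
    qed
    \<comment> \<open>Both candidates for the letter at \<open>i\<close> start an edge with the same
      end.\<close>
    then have "(s i, b.sc i) \<in> b.E" "(s' i, b.sc i) \<in> b.E"
      using False X step same_edges a.edges_iff[of "s i" "b.sc i"] by (auto simp: b.edges_iff)
    then show ?thesis by (rule b.edges_left_unique)
  qed
  then show ?case
    using step X by (metis Suc_leI le_neq_implies_less)
qed

end

lemma edges_inj:
  assumes "marked_word n s X" "marked_word n s' X'" "edges n s X = edges n s' X'"
  shows "X = X'" "\<And>i. i < n \<Longrightarrow> s i = s' i"
proof -
  interpret two_marked_words n s X s' X'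
    using assms by (simp add: two_marked_words_def two_marked_words_axioms_def)
  show "X = X'"
    using same_word[of 0] a.X_subset b.X_subset by blast
  show "\<And>i. i < n \<Longrightarrow> s i = s' i"
    using same_word[of 0] by blast
qed

section \<open>Filling the blanks of a word\<close>

fun fill :: "'a option list \<Rightarrow> 'a list \<Rightarrow> 'a list" where
  "fill [] js = []"
| "fill (Some a # w) js = a # fill w js"
| "fill (None # w) js = hd js # fill w (tl js)"

lemma length_fill [simp]: "length (fill w js) = length w"
  by (induction w js rule: fill.induct) auto

lemma fill_nth_Some: "i < length w \<Longrightarrow> w ! i = Some a \<Longrightarrow> fill w js ! i = a"
  by (induction w js arbitrary: i rule: fill.induct) (auto simp: nth_Cons split: nat.splits)

lemma fill_nth_None:
  "i < length w \<Longrightarrow> w ! i = None \<Longrightarrow> length (filter (\<lambda>x. x = None) w) = length js \<Longrightarrow>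
   fill w js ! i = js ! length (filter (\<lambda>x. x = None) (take i w))"
proof (induction w js arbitrary: i rule: fill.induct)
  case (2 a w js)
  then show ?case by (cases i) auto
next
  case (3 w js)
  then show ?case by (cases i; cases js) auto
qed simp

lemma length_filter_take_less:
  assumes "i < i'" "i' \<le> length w" "P (w ! i)"
  shows "length (filter P (take i w)) < length (filter P (take i' w))"
proof -
  have "take (Suc i) w = take i w @ [w ! i]"
    using assms by (simp add: take_Suc_conv_app_nth)
  moreover have "take i' w = take (Suc i) w @ take (i' - Suc i) (drop (Suc i) w)"
    using assms take_add[of "Suc i" "i' - Suc i" w] by simp
  ultimately show ?thesis using assms by simp
qed

section \<open>Descents of the filled word, block by block\<close>

lemma card_nat_split:
  assumes "finite {i. P (Suc i)}"
  shows "card {i. P i} = of_bool (P 0) + card {i. P (Suc i)}"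
proof -
  have "{i. P i} = {i. i = 0 \<and> P 0} \<union> Suc ` {i. P (Suc i)}"
    by (auto simp: image_iff) (metis not0_implies_Suc)+
  moreover have "card ({i. i = 0 \<and> P 0} \<union> Suc ` {i. P (Suc i)})
      = card {i::nat. i = 0 \<and> P 0} + card (Suc ` {i. P (Suc i)})"
    using assms by (intro card_Un_disjoint) auto
  ultimately show ?thesis by (auto simp: card_image)
qed

lemma des_word_Nil [simp]: "des_word [] = 0"
  and des_word_single [simp]: "des_word [a] = 0"
  by (simp_all add: des_word_def)

lemma des_word_Cons: "des_word (a # b # c) = of_bool (b < a) + des_word (b # c)"
proof -
  have "finite {i. i + 1 < length (b # c) \<and> (b # c) ! (i + 1) < (b # c) ! i}"
    by (rule finite_subset[of _ "{..<length (b # c)}"]) auto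
  then show ?thesis
    unfolding des_word_def by (subst card_nat_split) auto
qed

text \<open>A blank may end a descent but not start one: its letter closes a block and is never
  compared with the first letter of the next block.\<close>

definition des_fill :: "nat option list \<Rightarrow> nat list \<Rightarrow> nat" where
  "des_fill w js =
     card {i. Suc i < length w \<and> w ! i \<noteq> None \<and> fill w js ! Suc i < fill w js ! i}"

lemma des_fill_Cons:
  "des_fill (x # w) js =
     of_bool (w \<noteq> [] \<and> x \<noteq> None \<and> fill (x # w) js ! 1 < fill (x # w) js ! 0)
       + card {i. Suc i < length w \<and> w ! i \<noteq> None \<and>
                  fill (x # w) js ! Suc (Suc i) < fill (x # w) js ! Suc i}"
proof -
  have "finite {i. Suc i < length w \<and> w ! i \<noteq> None \<and>
                  fill (x # w) js ! Suc (Suc i) < fill (x # w) js ! Suc i}"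
    by (rule finite_subset[of _ "{..<length w}"]) auto
  then show ?thesis
    unfolding des_fill_def by (subst card_nat_split) auto
qed

text \<open>Locates the letter that a prepended letter will be compared with.
  \<open>take 1 js\<close> covers both cases: the first block is followed by its missing letter, or
  it is the whole word.\<close>

lemma fill_first_block:
  "length js = length (filter (\<lambda>x. x = None) w) \<Longrightarrow>
   \<exists>r. fill w js = hd (blocks w) @ take 1 js @ r \<and> (js = [] \<longrightarrow> r = [])"
proof (induction w js rule: fill.induct)
  case (3 w js)
  then show ?case by (cases js) auto
qed auto

text \<open>Induction from the front: a blank opens an empty block, whose one-letter word has no
  descent; a letter extends the first block and adds just the comparison with the next filled
  letter.\<close>

lemma blocks_eq_des_fill:
  assumes "length js = length (filter (\<lambda>x. x = None) w)"
  shows "(\<Sum>i<length js. des_word (blocks w ! i @ [js ! i])) + des_word (blocks w ! length js)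
    = des_fill w js"
  using assms
proof (induction w js rule: fill.induct)
  case (1 js)
  then show ?case by (simp add: des_fill_def)
next
  case (3 w js)
  then obtain j js' where js: "js = j # js'" by (cases js) auto
  have "des_fill (None # w) js = des_fill w js'"
    unfolding des_fill_Cons unfolding js by (simp add: des_fill_def)
  then show ?case
    using 3 by (simp add: js sum.lessThan_Suc_shift del: sum.lessThan_Suc)
next
  case (2 a w js)
  obtain b bs where b: "blocks w = b # bs"
    using length_blocks[of w] by (cases "blocks w") auto
  have R: "des_fill (Some a # w) js = of_bool (w \<noteq> [] \<and> fill w js ! 0 < a) + des_fill w js"
    unfolding des_fill_Cons by (simp add: des_fill_def)
  obtain r where r: "fill w js = b @ take 1 js @ r" "js = [] \<longrightarrow> r = []"
    using fill_first_block[of js w] 2 b by auto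
  have w: "w \<noteq> [] \<longleftrightarrow> fill w js \<noteq> []"
    by (metis length_0_conv length_fill)
  show ?case
  proof (cases js)
    case Nil
    then show ?thesis
      using 2 R r w by (cases b) (auto simp: b des_word_Cons)
  next
    case (Cons j js')
    have "des_word (a # b @ [j]) = of_bool (w \<noteq> [] \<and> fill w js ! 0 < a) + des_word (b @ [j])"
      using r w Cons by (cases b) (auto simp: des_word_Cons)
    moreover have "(\<Sum>i<length js. des_word (blocks w ! i @ [js ! i])) + des_word (blocks w ! length js)
        = des_fill w js"
      by (rule "2.IH") (use "2.prems" in simp)
    ultimately show ?thesis
      unfolding R by (simp add: Cons b sum.lessThan_Suc_shift del: sum.lessThan_Suc)
  qed
qed

section \<open>Partial permutations\<close>

definition letter :: "nat mat \<Rightarrow> nat \<Rightarrow> nat" where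
  "letter \<pi> i = fill (one_line \<pi>) (missing \<pi>) ! i"

context
  fixes n \<pi> assumes pp: "partial_permutation n \<pi>"
begin

lemma dims: "dim_row \<pi> = n" "dim_col \<pi> = n"
  using pp by (auto simp: partial_permutation_def)

lemma entry_cases: "i < n \<Longrightarrow> j < n \<Longrightarrow> \<pi> $$ (i, j) = 0 \<or> \<pi> $$ (i, j) = 1"
  using pp by (auto simp: partial_permutation_def)

lemma row_unique:
  assumes "i < n" "j < n" "j' < n" "\<pi> $$ (i, j) = 1" "\<pi> $$ (i, j') = 1"
  shows "j = j'"
proof -
  have "card {j. j < n \<and> \<pi> $$ (i, j) = 1} \<le> Suc 0"
    using pp assms by (auto simp: partial_permutation_def)
  then show ?thesis using assms by (subst (asm) card_le_Suc0_iff_eq) auto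
qed

lemma column_unique:
  assumes "i < n" "i' < n" "j < n" "\<pi> $$ (i, j) = 1" "\<pi> $$ (i', j) = 1"
  shows "i = i'"
proof -
  have "card {i. i < n \<and> \<pi> $$ (i, j) = 1} \<le> Suc 0"
    using pp assms by (auto simp: partial_permutation_def)
  then show ?thesis using assms by (subst (asm) card_le_Suc0_iff_eq) auto
qed

lemma zero_rows_subset: "zero_rows \<pi> \<subseteq> {..<n}"
  by (auto simp: zero_rows_def dims)

lemma length_one_line: "length (one_line \<pi>) = n"
  by (simp add: one_line_def dims)

lemma one_line_None: "i < n \<Longrightarrow> one_line \<pi> ! i = None \<longleftrightarrow> i \<in> zero_rows \<pi>"
  by (simp add: one_line_def dims)

lemma one_line_Some:
  assumes "i < n"
  shows "one_line \<pi> ! i = Some a \<longleftrightarrow> (\<exists>j<n. a = Suc j \<and> \<pi> $$ (i, j) = 1)"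
proof (cases "i \<in> zero_rows \<pi>")
  case True
  then show ?thesis using assms by (auto simp: one_line_def dims zero_rows_def)
next
  case False
  then obtain j where j: "j < n" "\<pi> $$ (i, j) = 1"
    using assms entry_cases by (fastforce simp: zero_rows_def dims)
  then have "(THE j. j < n \<and> \<pi> $$ (i, j) = 1) = j"
    using row_unique assms by blast
  then have "one_line \<pi> ! i = Some (Suc j)"
    using assms False by (simp add: one_line_def dims)
  then show ?thesis
    using j row_unique[OF assms j(1) _ j(2)] by (metis option.inject)
qed

lemma one_line_inj:
  "i < n \<Longrightarrow> i' < n \<Longrightarrow> one_line \<pi> ! i = Some a \<Longrightarrow> one_line \<pi> ! i' = Some a \<Longrightarrow> i = i'"
  using column_unique by (auto simp: one_line_Some)

lemma blanks: "length (filter (\<lambda>x. x = None) (one_line \<pi>)) = card (zero_rows \<pi>)"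
  unfolding length_filter_conv_card length_one_line
  using one_line_None zero_rows_subset by (intro arg_cong[of _ _ card]) auto

lemma set_missing: "set (missing \<pi>) = {1..n} - {a. Some a \<in> set (one_line \<pi>)}"
  unfolding missing_def by (auto simp: dims)

text \<open>The nonzero rows carry distinct letters, so \<open>n - card (zero_rows \<pi>)\<close>
  letters occur and the others are missing.\<close>

lemma length_missing: "length (missing \<pi>) = card (zero_rows \<pi>)"
proof -
  let ?A = "{a. Some a \<in> set (one_line \<pi>)}"
  let ?f = "\<lambda>i. the (one_line \<pi> ! i)"
  have ex: "\<exists>a. one_line \<pi> ! i = Some a" if "i \<in> {..<n} - zero_rows \<pi>" for i
    using that one_line_None by auto
  have inj: "inj_on ?f ({..<n} - zero_rows \<pi>)"
  proof (rule inj_onI)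
    fix i i' assume *: "i \<in> {..<n} - zero_rows \<pi>" "i' \<in> {..<n} - zero_rows \<pi>" "?f i = ?f i'"
    then show "i = i'"
      using ex[of i] ex[of i'] one_line_inj[of i i'] by auto
  qed
  have "?A = ?f ` ({..<n} - zero_rows \<pi>)"
  proof (intro Set.set_eqI iffI)
    fix a assume "a \<in> ?A"
    then obtain i where "i < n" "one_line \<pi> ! i = Some a"
      by (auto simp: in_set_conv_nth length_one_line)
    then show "a \<in> ?f ` ({..<n} - zero_rows \<pi>)"
      using one_line_None[of i] by (intro image_eqI[of _ _ i]) auto
  next
    fix a assume "a \<in> ?f ` ({..<n} - zero_rows \<pi>)"
    then obtain i where "i \<in> {..<n} - zero_rows \<pi>" "a = ?f i" by blast
    then show "a \<in> ?A"
      using ex[of i] nth_mem[of i "one_line \<pi>"] by (auto simp: length_one_line)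
  qed
  then have "card ?A = n - card (zero_rows \<pi>)"
    using inj zero_rows_subset by (simp add: card_image card_Diff_subset finite_subset)
  moreover have "?A \<subseteq> {1..n}"
    by (auto simp: in_set_conv_nth length_one_line one_line_Some)
  moreover have "card (zero_rows \<pi>) \<le> n"
    using card_mono[OF _ zero_rows_subset] by simp
  ultimately have "card (set (missing \<pi>)) = card (zero_rows \<pi>)"
    unfolding set_missing by (simp add: card_Diff_subset finite_subset)
  then show ?thesis
    by (simp add: missing_def)
qed

lemma letter_Some: "i < n \<Longrightarrow> one_line \<pi> ! i = Some a \<Longrightarrow> letter \<pi> i = a"
  by (simp add: letter_def fill_nth_Some length_one_line)

lemma letter_None:
  assumes "i \<in> zero_rows \<pi>"
  defines "r \<equiv> length (filter (\<lambda>x. x = None) (take i (one_line \<pi>)))"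
  shows "letter \<pi> i = missing \<pi> ! r" "r < length (missing \<pi>)"
proof -
  have i: "i < n" "one_line \<pi> ! i = None"
    using assms zero_rows_subset one_line_None by auto
  then show "letter \<pi> i = missing \<pi> ! r"
    unfolding letter_def r_def
    by (intro fill_nth_None) (auto simp: length_one_line blanks length_missing)
  show "r < length (missing \<pi>)"
    using length_filter_take_less[of i n "one_line \<pi>" "\<lambda>x. x = None"] i
    by (simp add: r_def length_missing length_one_line flip: blanks)
qed

text \<open>A later blank has more blanks before it, hence a larger index into the sorted list of
  missing letters.\<close>

lemma strict_mono_letter: "strict_mono_on (zero_rows \<pi>) (letter \<pi>)"
proof (rule strict_mono_onI)
  fix i i' assume *: "i \<in> zero_rows \<pi>" "i' \<in> zero_rows \<pi>" "i < i'"
  then have "length (filter (\<lambda>x. x = None) (take i (one_line \<pi>)))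
      < length (filter (\<lambda>x. x = None) (take i' (one_line \<pi>)))"
    using zero_rows_subset one_line_None
    by (intro length_filter_take_less) (auto simp: length_one_line)
  moreover have "sorted_wrt (<) (missing \<pi>)"
    by (simp add: missing_def)
  ultimately show "letter \<pi> i < letter \<pi> i'"
    using * letter_None by (auto simp: sorted_wrt_iff_nth_less)
qed

lemma letter_zero_row: "i \<in> zero_rows \<pi> \<Longrightarrow> letter \<pi> i \<in> set (missing \<pi>)"
  using letter_None[of i] by simp

lemma letter_nonzero_row: "i < n \<Longrightarrow> i \<notin> zero_rows \<pi> \<Longrightarrow> one_line \<pi> ! i = Some (letter \<pi> i)"
  using one_line_None[of i] letter_Some[of i] by auto

lemma marked_word_letter: "marked_word n (letter \<pi>) (zero_rows \<pi>)"
proof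
  show "zero_rows \<pi> \<subseteq> {..<n}" by (rule zero_rows_subset)
  show "strict_mono_on (zero_rows \<pi>) (letter \<pi>)" by (rule strict_mono_letter)
  have range: "letter \<pi> ` {..<n} \<subseteq> {1..n}"
  proof
    fix a assume "a \<in> letter \<pi> ` {..<n}"
    then obtain i where i: "i < n" "a = letter \<pi> i" by auto
    show "a \<in> {1..n}"
    proof (cases "i \<in> zero_rows \<pi>")
      case True
      then show ?thesis using letter_zero_row i set_missing by auto
    next
      case False
      then show ?thesis using letter_nonzero_row[of i] i one_line_Some[of i] by auto
    qed
  qed
  \<comment> \<open>The letter of a zero row is missing from the one-line notation, that of a
    nonzero row occurs in it.\<close>
  have mixed: "letter \<pi> i \<noteq> letter \<pi> i'"
    if "i \<in> zero_rows \<pi>" "i' < n" "i' \<notin> zero_rows \<pi>" for i i'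
    using that letter_zero_row[of i] letter_nonzero_row[of i'] nth_mem[of i' "one_line \<pi>"]
    by (auto simp: set_missing length_one_line)
  have "inj_on (letter \<pi>) {..<n}"
  proof (rule inj_onI)
    fix i i' assume *: "i \<in> {..<n}" "i' \<in> {..<n}" "letter \<pi> i = letter \<pi> i'"
    then consider "i \<in> zero_rows \<pi>" "i' \<in> zero_rows \<pi>" | "i \<notin> zero_rows \<pi>" "i' \<notin> zero_rows \<pi>"
      using mixed[of i i'] mixed[of i' i] by auto
    then show "i = i'"
    proof cases
      case 1
      then show ?thesis
        using * strict_mono_on_eqD[OF strict_mono_letter] by metis
    next
      case 2
      then show ?thesis
        using * letter_nonzero_row[of i] letter_nonzero_row[of i'] one_line_inj by auto
    qed
  qed
  then show "bij_betw (letter \<pi>) {..<n} {1..n}"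
    using range by (simp add: bij_betw_def card_subset_eq card_image)
qed

text \<open>Recovers the matrix from its filled word and its blanks, as injectivity of
  \<open>edge_matrix\<close> requires.\<close>

lemma entry_eq_1_iff:
  assumes "i < n" "j < n"
  shows "\<pi> $$ (i, j) = 1 \<longleftrightarrow> i \<notin> zero_rows \<pi> \<and> letter \<pi> i = Suc j"
  using assms one_line_Some[of i "Suc j"] one_line_None[of i] letter_Some[of i] by auto

lemma des_eq:
  "des \<pi> = card {i. Suc i < n \<and> i \<notin> zero_rows \<pi> \<and> letter \<pi> (Suc i) < letter \<pi> i}"
proof -
  have "des \<pi> = des_fill (one_line \<pi>) (missing \<pi>)"
    unfolding des_def Let_def
    using blocks_eq_des_fill[of "missing \<pi>" "one_line \<pi>"] by (simp add: blanks length_missing)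
  also have "\<dots> = card {i. Suc i < n \<and> i \<notin> zero_rows \<pi> \<and> letter \<pi> (Suc i) < letter \<pi> i}"
    unfolding des_fill_def letter_def length_one_line
    by (intro arg_cong[of _ _ card] Collect_cong) (metis Suc_lessD one_line_None)
  finally show ?thesis .
qed

end

section \<open>The matrix of edges and its statistics\<close>

text \<open>The edges are transposed, so that descents become excedances.\<close>

definition edge_matrix :: "nat \<Rightarrow> nat mat \<Rightarrow> nat mat" where
  "edge_matrix n \<pi> =
     mat n n (\<lambda>(r, c). of_bool ((Suc c, Suc r) \<in> edges n (letter \<pi>) (zero_rows \<pi>)))"

lemma dim_edge_matrix [simp]:
  "dim_row (edge_matrix n \<pi>) = n" "dim_col (edge_matrix n \<pi>) = n"
  by (simp_all add: edge_matrix_def)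

lemma edge_matrix_entry:
  assumes "r < n" "c < n"
  shows "edge_matrix n \<pi> $$ (r, c) = 1 \<longleftrightarrow> (Suc c, Suc r) \<in> edges n (letter \<pi>) (zero_rows \<pi>)"
    and "edge_matrix n \<pi> $$ (r, c) = 0 \<longleftrightarrow> (Suc c, Suc r) \<notin> edges n (letter \<pi>) (zero_rows \<pi>)"
  using assms by (simp_all add: edge_matrix_def)

context
  fixes n \<pi> assumes pp: "partial_permutation n \<pi>"
begin

interpretation marked_word n "letter \<pi>" "zero_rows \<pi>"
  by (rule marked_word_letter[OF pp])

lemma edge_matrix_partial_permutation: "partial_permutation n (edge_matrix n \<pi>)"
proof -
  have "card {c. c < n \<and> edge_matrix n \<pi> $$ (r, c) = 1} \<le> 1" if "r < n" for r
    unfolding One_nat_def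
  proof (subst card_le_Suc0_iff_eq, simp, intro ballI)
    fix c c' assume "c \<in> {c. c < n \<and> edge_matrix n \<pi> $$ (r, c) = Suc 0}"
      "c' \<in> {c. c < n \<and> edge_matrix n \<pi> $$ (r, c) = Suc 0}"
    then show "c = c'"
      using that edges_left_unique[of "Suc c" "Suc r" "Suc c'"]
        edge_matrix_entry(1)[of r n c \<pi>] edge_matrix_entry(1)[of r n c' \<pi>] by simp
  qed
  moreover have "card {r. r < n \<and> edge_matrix n \<pi> $$ (r, c) = 1} \<le> 1" if "c < n" for c
    unfolding One_nat_def
  proof (subst card_le_Suc0_iff_eq, simp, intro ballI)
    fix r r' assume "r \<in> {r. r < n \<and> edge_matrix n \<pi> $$ (r, c) = Suc 0}"
      "r' \<in> {r. r < n \<and> edge_matrix n \<pi> $$ (r, c) = Suc 0}"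
    then show "r = r'"
      using that edges_right_unique[of "Suc c" "Suc r" "Suc r'"]
        edge_matrix_entry(1)[of r n c \<pi>] edge_matrix_entry(1)[of r' n c \<pi>] by simp
  qed
  ultimately show ?thesis
    unfolding partial_permutation_def by (simp add: edge_matrix_def)
qed

text \<open>Zero rows correspond to letters that no edge enters. By injectivity of the successor,
  \<open>Range E\<close> has one element for each nonzero row of \<open>\<pi>\<close>.\<close>

lemma card_zero_rows_edge_matrix: "card (zero_rows (edge_matrix n \<pi>)) = card (zero_rows \<pi>)"
proof -
  have "zero_rows (edge_matrix n \<pi>) = {r. r < n \<and> (\<forall>c<n. (Suc c, Suc r) \<notin> E)}"
    using edge_matrix_entry(2)[of _ n _ \<pi>]
    by (auto simp: zero_rows_def[of "edge_matrix n \<pi>"])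
  then have "Suc ` zero_rows (edge_matrix n \<pi>) = {b \<in> {1..n}. \<forall>c<n. (Suc c, b) \<notin> E}"
    by (force simp: image_iff Suc_le_eq gr0_conv_Suc)
  also have "\<dots> = {1..n} - Range E"
  proof -
    have "\<exists>c<n. a = Suc c" if "(a, b) \<in> E" for a b
    proof -
      have "a \<in> {1..n}" using that edges_subset by auto
      then show ?thesis
        by (metis One_nat_def Suc_le_D Suc_le_lessD atLeastAtMost_iff)
    qed
    then show ?thesis by blast
  qed
  finally have "card (zero_rows (edge_matrix n \<pi>)) = card ({1..n} - Range E)"
    by (metis card_image inj_Suc)
  also have "\<dots> = n - card (Range E)"
  proof -
    have "Range E \<subseteq> {1..n}" using edges_subset by blast
    then show ?thesis by (simp add: card_Diff_subset finite_subset)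
  qed
  also have "card (Range E) = n - card (zero_rows \<pi>)"
    unfolding Range_edges card_image[OF successor_inj]
    by (simp add: card_Diff_subset X_subset finite_subset[OF X_subset])
  also have "n - (n - card (zero_rows \<pi>)) = card (zero_rows \<pi>)"
    using card_mono[OF _ X_subset] by simp
  finally show ?thesis .
qed

lemma exc_edge_matrix: "exc (edge_matrix n \<pi>) = des \<pi>"
proof -
  let ?D = "{i. i < n \<and> i \<notin> zero_rows \<pi> \<and> sc i < letter \<pi> i}"
  have "{r. r < dim_row (edge_matrix n \<pi>) \<and> (\<exists>c<dim_col (edge_matrix n \<pi>). c > r \<and> edge_matrix n \<pi> $$ (r, c) = 1)}
      = {r. r < n \<and> (\<exists>c<n. r < c \<and> (Suc c, Suc r) \<in> E)}"
    unfolding dim_edge_matrix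
    by (intro Collect_cong conj_cong refl ex_cong) (metis edge_matrix_entry(1))
  then have "exc (edge_matrix n \<pi>) = card (Suc ` {r. r < n \<and> (\<exists>c<n. r < c \<and> (Suc c, Suc r) \<in> E)})"
    by (simp add: exc_def card_image)
  \<comment> \<open>Excedances are counted by rows, i.e. by ends of descending edges; injectivity of
    \<open>sc\<close> then moves the count to positions of the word.\<close>
  also have "Suc ` {r. r < n \<and> (\<exists>c<n. r < c \<and> (Suc c, Suc r) \<in> E)} = sc ` ?D"
  proof (intro Set.set_eqI iffI)
    fix b assume "b \<in> Suc ` {r. r < n \<and> (\<exists>c<n. r < c \<and> (Suc c, Suc r) \<in> E)}"
    then obtain r c where "b = Suc r" "r < c" "(Suc c, Suc r) \<in> E" by blast
    then obtain i where "i < n" "i \<notin> zero_rows \<pi>" "b = sc i" "sc i < letter \<pi> i"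
      unfolding edges_iff by (metis Suc_less_eq)
    then show "b \<in> sc ` ?D" by blast
  next
    fix b assume "b \<in> sc ` ?D"
    then obtain i where i: "i < n" "i \<notin> zero_rows \<pi>" "b = sc i" "sc i < letter \<pi> i" by auto
    then have e: "(letter \<pi> i, b) \<in> E" by (auto simp: edges_iff)
    then have "letter \<pi> i \<in> {1..n}" "b \<in> {1..n}" using edges_subset by auto
    then obtain r c where "b = Suc r" "letter \<pi> i = Suc c" "r < n" "c < n"
      by (metis One_nat_def Suc_le_D Suc_le_lessD atLeastAtMost_iff)
    then show "b \<in> Suc ` {r. r < n \<and> (\<exists>c<n. r < c \<and> (Suc c, Suc r) \<in> E)}"
      using e i by auto
  qed
  also have "card (sc ` ?D) = card ?D"
    by (intro card_image inj_on_subset[OF successor_inj]) auto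
  also have "?D = {i. Suc i < n \<and> i \<notin> zero_rows \<pi> \<and> letter \<pi> (Suc i) < letter \<pi> i}"
    using descent_successor_iff by auto
  finally show ?thesis by (simp add: des_eq[OF pp])
qed

end

section \<open>Injectivity and equidistribution\<close>

lemma edge_matrix_inj:
  assumes pp: "partial_permutation n \<pi>" "partial_permutation n \<pi>'"
    and eq: "edge_matrix n \<pi> = edge_matrix n \<pi>'"
  shows "\<pi> = \<pi>'"
proof -
  interpret a: marked_word n "letter \<pi>" "zero_rows \<pi>" by (rule marked_word_letter[OF pp(1)])
  interpret b: marked_word n "letter \<pi>'" "zero_rows \<pi>'" by (rule marked_word_letter[OF pp(2)])
  \<comment> \<open>Matrix entries only record pairs within \<open>{1..n}\<close>, and edges have no
    others.\<close>
  have "(x, y) \<in> a.E \<longleftrightarrow> (x, y) \<in> b.E" for x y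
  proof (cases "x \<in> {1..n} \<and> y \<in> {1..n}")
    case True
    then obtain c r where "x = Suc c" "y = Suc r" "c < n" "r < n"
      by (metis One_nat_def Suc_le_D Suc_le_lessD atLeastAtMost_iff)
    then show ?thesis
      using eq edge_matrix_entry(1)[of r n c \<pi>] edge_matrix_entry(1)[of r n c \<pi>'] by simp
  next
    case False
    then show ?thesis using a.edges_subset b.edges_subset by blast
  qed
  then have "a.E = b.E" by auto
  note same = edges_inj[OF a.marked_word_axioms b.marked_word_axioms this]
  show ?thesis
  proof (rule eq_matI)
    fix i j assume "i < dim_row \<pi>'" "j < dim_col \<pi>'"
    then have ij: "i < n" "j < n" by (simp_all add: dims[OF pp(2)])
    then show "\<pi> $$ (i, j) = \<pi>' $$ (i, j)"
      using same entry_eq_1_iff[OF pp(1) ij] entry_eq_1_iff[OF pp(2) ij]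
        entry_cases[OF pp(1) ij] entry_cases[OF pp(2) ij] by auto
  qed (simp_all add: dims[OF pp(1)] dims[OF pp(2)])
qed

theorem theorem4p2:
  fixes n k m :: nat
  shows "card {\<pi> \<in> partial_perms n k. des \<pi> = m} = card {\<pi> \<in> partial_perms n k. exc \<pi> = m}"
proof -
  let ?P = "partial_perms n k" and ?f = "edge_matrix n"
  have inj: "inj_on ?f ?P"
    by (auto simp: partial_perms_def inj_on_def intro: edge_matrix_inj)
  have "?f ` ?P \<subseteq> ?P"
    by (auto simp: partial_perms_def edge_matrix_partial_permutation card_zero_rows_edge_matrix)
  then have onto: "?f ` ?P = ?P"
    using inj by (rule endo_inj_surj[OF finite_partial_perms])
  have exc: "exc (?f \<pi>) = des \<pi>" if "\<pi> \<in> ?P" for \<pi>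
    using that exc_edge_matrix by (simp add: partial_perms_def)
  \<comment> \<open>Surjectivity supplies a preimage for each element on the right, and
    \<open>exc\<close> identifies its number of descents as \<open>m\<close>.\<close>
  have "?f ` {\<pi> \<in> ?P. des \<pi> = m} = {\<pi> \<in> ?P. exc \<pi> = m}" (is "?f ` ?D = ?E")
    using onto exc by (auto simp: image_iff) (metis (no_types, lifting) image_iff)
  then have "card ?E = card (?f ` ?D)" by simp
  also have "\<dots> = card ?D"
    by (rule card_image, rule inj_on_subset[OF inj]) blast
  finally show ?thesis by simp
qed

end
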